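(* Let $0<a<\frac13$ and let $G:\mathbb{T}^2\to\mathbb{T}^2$, $\mathbb{T}^2=\mathbb{R}^2/(2\pi\mathbb{Z})^2$, be the diffeomorphism induced by $$G(x,y)=\bigl(x+2a\sin x+a\sin y+a\sin(x-y),\; y+a\sin x+2a\sin y+a\sin(y-x)\bigr)\pmod{2\pi}.$$ Let $H_1=\{(\frac{2\pi}{3},\frac{4\pi}{3})\}$ and let $S$ be the open set $$S=\{(x,y)\in\,]0,2\pi[\,\times\,]0,2\pi[\;:\; y>x\}.$$ Then the function $$V(x,y)=|y-2x|+|2\pi+x-2y|$$ is a strict Lyapunov function for $G$ on $S$ (with respect to $H_1$), and $H_1$ is asymptotically stable for $G$.
   Context: For $0<a<\frac13$ the map $G$ is a diffeomorphism of $\mathbb{T}^2$. The set $S$ is invariant under $G$; points of $S$ and their images are represented by coordinates in $]0,2\pi[^2$. The discrete orbital derivative of $V$ is $\dot V(x,y)=V(G(x,y))-V(x,y)$. A continuous function $V$ on an open set $S$ is a Lyapunov function for $G$ on $S$ if $\dot V\le 0$ on $S$; it is a strict Lyapunov function on $S$ with respect to a compact set $H\subset S$ if in addition $V= 0$ on $H$, $V>0$ on $S\setminus H$ and $\dot V<0$ on $S\setminus H$. A compact set $H$ is Lyapunov stable if for every neighbourhood $U$ of $H$ there is a neighbourhood $W$ of $H$ such that $G^n(z)\in U$ for all $z\in W$, $n\ge 0$; it is asymptotically stable if it is Lyapunov stable and there is a neighbourhood of $H$ all of whose points $z$ satisfy $\operatorname{dist}(G^n(z),H)\to 0$ as $n\to+\infty$.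 *)

theory Defs
  imports "HOL-Analysis.Analysis" "HOL-Library.Real_Mod"
begin

definition lattice_cong :: "real \<times> real \<Rightarrow> real \<times> real \<Rightarrow> bool" where
  "lattice_cong u v \<longleftrightarrow> [fst u = fst v] (rmod (2 * pi)) \<and> [snd u = snd v] (rmod (2 * pi))"

lemma lattice_cong_refl [simp]: "lattice_cong u u"
  by (simp add: lattice_cong_def)

lemma lattice_cong_sym: "lattice_cong u v \<Longrightarrow> lattice_cong v u"
  by (auto simp: lattice_cong_def intro: rcong_sym)

lemma lattice_cong_trans: "lattice_cong u v \<Longrightarrow> lattice_cong v w \<Longrightarrow> lattice_cong u w"
  by (auto simp: lattice_cong_def intro: rcong_trans)

lemma lattice_cong_add: "lattice_cong u v \<Longrightarrow> lattice_cong u' v' \<Longrightarrow> lattice_cong (u + u') (v + v')"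
  by (auto simp: lattice_cong_def intro: rcong_add)

lemma lattice_cong_diff: "lattice_cong u v \<Longrightarrow> lattice_cong u' v' \<Longrightarrow> lattice_cong (u - u') (v - v')"
  by (auto simp: lattice_cong_def intro: rcong_diff)

quotient_type torus2 = "real \<times> real" / lattice_cong
  morphisms rep_torus2 torus_proj
  by (intro equivpI reflpI sympI transpI) (auto intro: lattice_cong_sym lattice_cong_trans)

lemma torus_proj_eq_iff: "torus_proj u = torus_proj v \<longleftrightarrow> lattice_cong u v"
  by (rule torus2.abs_eq_iff)

lemma torus_proj_cases: obtains u where "p = torus_proj u"
  by (metis Quotient_abs_rep[OF Quotient_torus2])

lemma closed_lattice_class: "closed {w. lattice_cong v w}"
proof -
  have *: "[x = y] (rmod (2 * pi)) \<longleftrightarrow> (y - x) / (2 * pi) \<in> \<int>" for x y :: real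
    by (auto simp: rcong_altdef Ints_def field_simps)
  have "{w. lattice_cong v w} =
      (\<lambda>w. (fst w - fst v) / (2 * pi)) -` \<int> \<inter> (\<lambda>w. (snd w - snd v) / (2 * pi)) -` \<int>"
    by (auto simp: lattice_cong_def *)
  also have "closed \<dots>"
    by (intro closed_Int closed_vimage closed_Ints continuous_intros) auto
  finally show ?thesis .
qed

lemma lattice_class_cong: "lattice_cong v v' \<Longrightarrow> {w. lattice_cong v w} = {w. lattice_cong v' w}"
  by (auto intro: lattice_cong_sym lattice_cong_trans)

lemma infdist_lattice_class_le:
  assumes "lattice_cong u u'"
  shows "infdist u' {w. lattice_cong v w} \<le> infdist u {w. lattice_cong v w}"
proof -
  have "infdist u' {w. lattice_cong v w} \<le> dist u w" if "lattice_cong v w" for w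
  proof (rule infdist_le2)
    have "lattice_cong (v + 0) (w + (u' - u))"
      using that lattice_cong_diff[OF lattice_cong_sym[OF assms] lattice_cong_refl[of u]]
      by (intro lattice_cong_add) (auto intro: lattice_cong_sym)
    then show "w + (u' - u) \<in> {w. lattice_cong v w}"
      by simp
    show "dist u' (w + (u' - u)) \<le> dist u w"
      by (simp add: dist_norm algebra_simps)
  qed
  moreover have "{w. lattice_cong v w} \<noteq> {}"
    using lattice_cong_refl by blast
  ultimately show ?thesis
    by (subst (2) infdist_notempty) (auto intro!: cINF_greatest)
qed

lemma infdist_lattice_class_cong:
  assumes "lattice_cong u u'" "lattice_cong v v'"
  shows "infdist u {w. lattice_cong v w} = infdist u' {w. lattice_cong v' w}"
  using infdist_lattice_class_le[OF assms(1)] infdist_lattice_class_le[OF lattice_cong_sym[OF assms(1)]]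
  by (simp add: lattice_class_cong[OF assms(2)] antisym)

text \<open>The flat quotient metric: the least Euclidean distance between representatives.\<close>

instantiation torus2 :: metric_space
begin

lift_definition dist_torus2 :: "torus2 \<Rightarrow> torus2 \<Rightarrow> real"
  is "\<lambda>u v. infdist u {w. lattice_cong v w}"
  by (rule infdist_lattice_class_cong)

definition uniformity_torus2 :: "(torus2 \<times> torus2) filter" where
  "uniformity_torus2 = (INF e\<in>{0<..}. principal {(x, y). dist x y < e})"

definition open_torus2 :: "torus2 set \<Rightarrow> bool" where
  "open_torus2 U \<longleftrightarrow> (\<forall>x\<in>U. \<forall>\<^sub>F (x', y) in uniformity. x' = x \<longrightarrow> y \<in> U)"

instance
proof
  fix p q r :: torus2
  obtain u v w where uvw: "p = torus_proj u" "q = torus_proj v" "r = torus_proj w"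
    by (metis torus_proj_cases)
  have ne: "{x. lattice_cong y x} \<noteq> {}" for y
    using lattice_cong_refl by blast
  show "dist p q = 0 \<longleftrightarrow> p = q"
    using in_closed_iff_infdist_zero[OF closed_lattice_class ne, of u v]
    by (auto simp: uvw dist_torus2.abs_eq torus_proj_eq_iff dest: lattice_cong_sym)
  have sym: "infdist y {x. lattice_cong z x} \<le> infdist z {x. lattice_cong y x}" for y z
  proof -
    have "infdist y {x. lattice_cong z x} \<le> dist z x" if "lattice_cong y x" for x
    proof -
      have "infdist y {x. lattice_cong z x} = infdist x {x. lattice_cong z x}"
        using that by (intro infdist_lattice_class_cong) auto
      also have "\<dots> \<le> dist x z"
        by (rule infdist_le) simp
      finally show ?thesis
        by (simp add: dist_commute)
    qed
    then show ?thesis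
      by (subst (2) infdist_notempty[OF ne]) (auto intro!: cINF_greatest ne)
  qed
  have "infdist u {x. lattice_cong v x} - infdist w {x. lattice_cong v x} \<le> dist u x"
    if "lattice_cong w x" for x
    using infdist_triangle[of u "{x. lattice_cong v x}" x]
      infdist_lattice_class_cong[OF that lattice_cong_refl[of v]] by simp
  then have "infdist u {x. lattice_cong v x} - infdist w {x. lattice_cong v x}
      \<le> infdist u {x. lattice_cong w x}"
    by (subst (3) infdist_notempty[OF ne]) (auto intro!: cINF_greatest ne)
  then show "dist p q \<le> dist p r + dist q r"
    using sym[of w v] by (simp add: uvw dist_torus2.abs_eq)
qed (fact uniformity_torus2_def open_torus2_def)+

end

lemma dist_torus_proj_le: "dist (torus_proj u) (torus_proj v) \<le> dist u v"
  by (simp add: dist_torus2.abs_eq infdist_le)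

text \<open>The metric induces the quotient topology of the plane modulo the lattice.\<close>

lemma open_torus2_iff: "open U \<longleftrightarrow> open (torus_proj -` U)"
proof
  assume "open U"
  show "open (torus_proj -` U)"
    unfolding open_dist
  proof
    fix u assume "u \<in> torus_proj -` U"
    then obtain e where e: "e > 0" "\<And>q. dist q (torus_proj u) < e \<Longrightarrow> q \<in> U"
      using \<open>open U\<close> unfolding open_dist by auto
    then show "\<exists>e>0. \<forall>v. dist v u < e \<longrightarrow> v \<in> torus_proj -` U"
      using dist_torus_proj_le le_less_trans by (metis vimageI)
  qed
next
  assume *: "open (torus_proj -` U)"
  show "open U"
    unfolding open_dist
  proof
    fix p assume "p \<in> U"
    obtain u where u: "p = torus_proj u" by (rule torus_proj_cases)
    then have "u \<in> torus_proj -` U" using \<open>p \<in> U\<close> by simp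
    then obtain e where e: "e > 0" "\<And>v. dist v u < e \<Longrightarrow> torus_proj v \<in> U"
      using * unfolding open_dist by (metis vimageE)
    have "q \<in> U" if "dist q p < e" for q
    proof -
      obtain v where v: "q = torus_proj v" by (rule torus_proj_cases)
      have ne: "{w. lattice_cong v w} \<noteq> {}"
        using lattice_cong_refl by blast
      have "infdist u {w. lattice_cong v w} < e"
        using that by (simp add: u v dist_commute dist_torus2.abs_eq[symmetric])
      then obtain w where "lattice_cong v w" "dist u w < e"
        using infdist_notempty[OF ne, of u] cINF_less_iff[OF ne, of "dist u" e]
        by (auto intro: bdd_belowI2[of _ 0] simp del: split_paired_Ex)
      then show ?thesis
        using e(2)[of w] torus_proj_eq_iff[of v w] by (simp add: v dist_commute)
    qed
    with e(1) show "\<exists>e>0. \<forall>q. dist q p < e \<longrightarrow> q \<in> U" by blast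
  qed
qed

text \<open>The coordinates of the representative in \<open>[0, 2\<pi>[ \<times> [0, 2\<pi>[\<close>.\<close>

lift_definition torus_coords :: "torus2 \<Rightarrow> real \<times> real"
  is "\<lambda>(x, y). (x rmod (2 * pi), y rmod (2 * pi))"
  by (auto simp: lattice_cong_def rcong_def)

lemma torus_coords_proj:
  "0 \<le> x \<Longrightarrow> x < 2 * pi \<Longrightarrow> 0 \<le> y \<Longrightarrow> y < 2 * pi \<Longrightarrow> torus_coords (torus_proj (x, y)) = (x, y)"
  by (simp add: torus_coords.abs_eq)

definition set_neighbourhood :: "'a::topological_space set \<Rightarrow> 'a set \<Rightarrow> bool" where
  "set_neighbourhood U H \<longleftrightarrow> (\<exists>T. open T \<and> H \<subseteq> T \<and> T \<subseteq> U)"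

definition lyapunov_stable :: "('a::topological_space \<Rightarrow> 'a) \<Rightarrow> 'a set \<Rightarrow> bool" where
  "lyapunov_stable G H \<longleftrightarrow> compact H \<and>
     (\<forall>U. set_neighbourhood U H \<longrightarrow>
       (\<exists>W. set_neighbourhood W H \<and> (\<forall>z\<in>W. \<forall>n. (G ^^ n) z \<in> U)))"

definition asymptotically_stable :: "('a::metric_space \<Rightarrow> 'a) \<Rightarrow> 'a set \<Rightarrow> bool" where
  "asymptotically_stable G H \<longleftrightarrow> lyapunov_stable G H \<and>
     (\<exists>W. set_neighbourhood W H \<and> (\<forall>z\<in>W. (\<lambda>n. infdist ((G ^^ n) z) H) \<longlonglongrightarrow> 0))"

definition orbital_derivative :: "('a \<Rightarrow> 'a) \<Rightarrow> ('a \<Rightarrow> real) \<Rightarrow> 'a \<Rightarrow> real" where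
  "orbital_derivative G V z = V (G z) - V z"

definition lyapunov_function ::
  "('a::topological_space \<Rightarrow> 'a) \<Rightarrow> 'a set \<Rightarrow> ('a \<Rightarrow> real) \<Rightarrow> bool" where
  "lyapunov_function G S V \<longleftrightarrow>
     open S \<and> continuous_on S V \<and> (\<forall>z\<in>S. orbital_derivative G V z \<le> 0)"

definition strict_lyapunov_function ::
  "('a::topological_space \<Rightarrow> 'a) \<Rightarrow> 'a set \<Rightarrow> 'a set \<Rightarrow> ('a \<Rightarrow> real) \<Rightarrow> bool" where
  "strict_lyapunov_function G S H V \<longleftrightarrow>
     lyapunov_function G S V \<and> compact H \<and> H \<subseteq> S \<and>
     (\<forall>z\<in>H. V z = 0) \<and> (\<forall>z\<in>S - H. V z > 0) \<and> (\<forall>z\<in>S - H. orbital_derivative G V z < 0)"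

definition plane_map :: "real \<Rightarrow> real \<times> real \<Rightarrow> real \<times> real" where
  "plane_map a = (\<lambda>(x, y).
     (x + 2 * a * sin x + a * sin y + a * sin (x - y),
      y + a * sin x + 2 * a * sin y + a * sin (y - x)))"

lift_definition torus_map :: "real \<Rightarrow> torus2 \<Rightarrow> torus2" is plane_map
proof -
  fix a :: real and u v :: "real \<times> real"
  assume "lattice_cong u v"
  then obtain x y x' y' where uv: "u = (x, y)" "v = (x', y')"
    and c: "[x = x'] (rmod (2 * pi))" "[y = y'] (rmod (2 * pi))"
    by (cases u; cases v) (auto simp: lattice_cong_def)
  have "sin x = sin x'" "sin y = sin y'" "sin (x - y) = sin (x' - y')" "sin (y - x) = sin (y' - x')"
    using c by (auto intro!: sin_rcong rcong_diff)
  with c show "lattice_cong (plane_map a u) (plane_map a v)"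
    by (auto simp: uv lattice_cong_def plane_map_def intro!: rcong_add)
qed

definition triangle_region :: "(real \<times> real) set" where
  "triangle_region = {(x, y). 0 < x \<and> x < 2 * pi \<and> 0 < y \<and> y < 2 * pi \<and> y > x}"

definition S_torus :: "torus2 set" where
  "S_torus = torus_proj ` triangle_region"

definition H1 :: "torus2 set" where
  "H1 = {torus_proj (2 * pi / 3, 4 * pi / 3)}"

definition V_torus :: "torus2 \<Rightarrow> real" where
  "V_torus p = (case torus_coords p of (x, y) \<Rightarrow> \<bar>y - 2 * x\<bar> + \<bar>2 * pi + x - 2 * y\<bar>)"

text \<open>
  Invariance of the region: the orbital derivative of \<open>V_torus\<close> on \<open>S_torus\<close> only involves
  coordinates in \<open>]0, 2\<pi>[ \<times> ]0, 2\<pi>[\<close>. The three gaps \<open>x\<close>, \<open>y - x\<close>, \<open>2\<pi> - y\<close> are all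
  transformed in the same way, and stay positive.
\<close>

lemma gap_pos:
  fixes a d p q :: real
  assumes a: "0 < a" "a < 1/3" and d: "0 < d" "d < 2 * pi" and sum: "d + p + q = 2 * pi"
  shows "0 < d + a * (2 * sin d - sin p - sin q)"
proof -
  define t where "t = d / 2"
  have t: "0 < t" "t < pi" using d by (auto simp: t_def)
  have s: "0 < sin t" using t by (rule sin_gt_zero)
  have "(p + q) / 2 = pi - t" using sum by (simp add: t_def field_simps)
  then have "sin ((p + q) / 2) = sin t" by (metis sin_pi_minus)
  then have pq: "sin p + sin q = 2 * sin t * cos ((p - q) / 2)"
    by (simp only: sin_plus_sin)
  have "sin d = 2 * sin t * cos t"
    using sin_double[of t] by (simp add: t_def)
  then have eq: "2 * sin d - sin p - sin q = 2 * sin t * (2 * cos t - cos ((p - q) / 2))"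
    using pq by (simp add: algebra_simps)
  have "-3 \<le> 2 * cos t - cos ((p - q) / 2)"
    using cos_ge_minus_one[of t] cos_le_one[of "(p - q) / 2"] by linarith
  then have "2 * sin t * (-3) \<le> 2 * sin t * (2 * cos t - cos ((p - q) / 2))"
    using s by (intro mult_left_mono) auto
  then have "a * (2 * sin t * (-3)) \<le> a * (2 * sin d - sin p - sin q)"
    unfolding eq using a by (simp only: mult_left_mono)
  moreover have "a * (6 * sin t) < 1/3 * (6 * sin t)"
    using a s by (intro mult_strict_right_mono) auto
  moreover have "sin t \<le> t" using t sin_x_le_x by simp
  ultimately show ?thesis by (simp add: t_def)
qed

lemma plane_map_triangle_region:
  assumes "0 < a" "a < 1/3" "u \<in> triangle_region"
  shows "plane_map a u \<in> triangle_region"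
proof -
  obtain x y where u: "u = (x, y)" and xy: "0 < x" "x < y" "y < 2 * pi"
    using assms(3) by (auto simp: triangle_region_def)
  have sy: "sin (2 * pi - y) = - sin y" by (simp add: sin_diff)
  have sd: "sin (y - x) = - sin (x - y)" by (metis minus_diff_eq sin_minus)
  show ?thesis
    using gap_pos[OF assms(1,2), of x "y - x" "2 * pi - y", unfolded sy sd]
      gap_pos[OF assms(1,2), of "y - x" x "2 * pi - y", unfolded sy sd]
      gap_pos[OF assms(1,2), of "2 * pi - y" x "y - x", unfolded sy sd] xy
    by (simp add: u triangle_region_def plane_map_def sd algebra_simps)
qed

lemma torus_map_S_torus: "0 < a \<Longrightarrow> a < 1/3 \<Longrightarrow> torus_map a ` S_torus \<subseteq> S_torus"
  by (auto simp: S_torus_def torus_map.abs_eq intro!: plane_map_triangle_region)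

end

(* In the gaps d1 = x, d2 = y - x, d3 = 2 pi - y, which are positive with sum 2 pi, the map acts by
   di |-> f di - c, where f t = t + 3 a sin t is strictly increasing and c does not depend on i, and
   V = |d2 - d1| + |d3 - d2|. Hence the order of the gaps is preserved, and V decreases because
   sin d - sin p = -2 cos (q/2) sin ((d - p)/2) for gaps d, p, q; the only case in which the third
   gap q may exceed pi is that of d2 being the smallest gap, which is settled by
   2 sin d2 - sin d1 - sin d3 = 2 sin (d2/2) (2 cos (d2/2) - cos ((d1 - d3)/2)).
   Since V dominates the distance to the equilibrium, small sublevel sets of V are compact,
   invariant neighbourhoods of it. *)
theory Submission
  imports Defs
begin

section \<open>Sines of three gaps with sum 2 pi\<close>

lemma sin_diff_gaps:
  fixes d p q :: real
  assumes "d + p + q = 2 * pi"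
  shows "sin d - sin p = - 2 * cos (q / 2) * sin ((d - p) / 2)"
proof -
  have "(d + p) / 2 = pi - q / 2" using assms by (simp add: field_simps)
  then have "cos ((d + p) / 2) = - cos (q / 2)" by (metis cos_pi_minus)
  then show ?thesis using sin_diff_sin[of d p] by simp
qed

text \<open>In the product formula, q < pi makes cos (q/2) positive, and 0 < d - p < 2 pi makes the
  half-difference have positive sine.\<close>

lemma sin_gap_less:
  fixes d p q :: real
  assumes "d + p + q = 2 * pi" "p < d" "0 < p" "0 < q" "q < pi"
  shows "sin d < sin p"
proof -
  have "0 < cos (q / 2)" using assms by (intro cos_gt_zero) auto
  moreover have "0 < sin ((d - p) / 2)" using assms by (intro sin_gt_zero) auto
  ultimately have "0 < cos (q / 2) * sin ((d - p) / 2)" by (rule mult_pos_pos)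
  then show ?thesis using sin_diff_gaps[OF assms(1)] by simp
qed

text \<open>A smallest gap that is not equal to both others lies below 2 pi / 3, so 2 cos (d/2) > 1,
  which beats the cosine factor of sin p + sin q. This holds even when p or q exceeds pi, where the
  cosine of its half is no longer positive.\<close>

lemma smallest_gap_sin:
  fixes d p q :: real
  assumes sum: "d + p + q = 2 * pi" and d: "0 < d" "d \<le> p" "d \<le> q" "\<not> (d = p \<and> d = q)"
  shows "sin p + sin q < 2 * sin d"
proof -
  define t where "t = d / 2"
  have t: "0 < t" "t < pi / 3" using sum d by (auto simp: t_def)
  have s: "0 < sin t" using t by (intro sin_gt_zero) auto
  have "cos (pi / 3) < cos t" using t by (intro cos_monotone_0_pi) auto
  then have c: "cos ((p - q) / 2) < 2 * cos t"
    using cos_le_one[of "(p - q) / 2"] unfolding cos_60 by linarith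
  have "(p + q) / 2 = pi - t" using sum by (simp add: t_def field_simps)
  then have "sin ((p + q) / 2) = sin t" by (metis sin_pi_minus)
  then have "sin p + sin q = 2 * sin t * cos ((p - q) / 2)"
    by (simp only: sin_plus_sin)
  also have "\<dots> < 2 * sin t * (2 * cos t)" using s c by (intro mult_strict_left_mono) auto
  also have "\<dots> = 2 * sin d" using sin_double[of t] by (simp add: t_def)
  finally show ?thesis .
qed

text \<open>The derivative 1 + b cos r is at least 1 - b. With b = 3 a, positivity is the condition
  a < 1/3.\<close>

lemma strict_mono_add_sin:
  fixes b :: real
  assumes "0 \<le> b" "b < 1"
  shows "strict_mono (\<lambda>t. t + b * sin t)"
proof (rule strict_monoI)
  fix s t :: real assume "s < t"
  have "(\<exists>D. ((\<lambda>t. t + b * sin t) has_real_derivative D) (at r) \<and> 0 < D)" for r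
  proof (intro exI conjI)
    show "((\<lambda>t. t + b * sin t) has_real_derivative 1 + b * cos r) (at r)"
      by (auto intro!: derivative_eq_intros)
    have "b * (- 1) \<le> b * cos r" using assms by (intro mult_left_mono) auto
    then show "0 < 1 + b * cos r" using assms by simp
  qed
  then show "s + b * sin s < t + b * sin t"
    by (rule DERIV_pos_imp_increasing[OF \<open>s < t\<close>, where f = "\<lambda>t. t + b * sin t"])
qed

lemma gap_differences_decrease:
  fixes b d1 d2 d3 :: real
  assumes b: "0 < b" "b < 1" and sum: "d1 + d2 + d3 = 2 * pi"
    and pos: "0 < d1" "0 < d2" "0 < d3" and ne: "\<not> (d1 = d2 \<and> d2 = d3)"
  defines "f \<equiv> \<lambda>t. t + b * sin t"
  shows "\<bar>f d2 - f d1\<bar> + \<bar>f d3 - f d2\<bar> < \<bar>d2 - d1\<bar> + \<bar>d3 - d2\<bar>"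
proof -
  have mono: "f s \<le> f t" if "s \<le> t" for s t
    using monoD[OF strict_mono_mono[OF strict_mono_add_sin] that, of b] b by (simp add: f_def)
  \<comment> \<open>Because \<open>f\<close> is increasing, each absolute value opens with the same
    sign before and after the map; what remains is the sign of a combination of sines.\<close>
  have up: "\<bar>f t - f s\<bar> = t - s + (b * sin t - b * sin s)" "\<bar>t - s\<bar> = t - s"
    and down: "\<bar>f s - f t\<bar> = t - s + (b * sin t - b * sin s)" "\<bar>s - t\<bar> = t - s"
    if "s \<le> t" for s t
    using mono[OF that] that by (simp_all add: f_def)
  have less: "b * s < b * t" if "s < t" for s t
    using b that by simp
  have s21: "sin d2 < sin d1" if "d1 < d2" "d3 < pi"
    by (rule sin_gap_less[of d2 d1 d3]) (use that pos sum in linarith)+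
  have s23: "sin d2 < sin d3" if "d3 < d2" "d1 < pi"
    by (rule sin_gap_less[of d2 d3 d1]) (use that pos sum in linarith)+
  have s13: "sin d1 < sin d3" if "d3 < d1" "d2 < pi"
    by (rule sin_gap_less[of d1 d3 d2]) (use that pos sum in linarith)+
  have s31: "sin d3 < sin d1" if "d1 < d3" "d2 < pi"
    by (rule sin_gap_less[of d3 d1 d2]) (use that pos sum in linarith)+
  \<comment> \<open>The middle gap \<open>d2\<close> occurs in both differences: it is a minimum, a
    maximum, or lies between the other two in one of two orders.\<close>
  consider "d2 \<le> d1" "d2 \<le> d3" | "d1 \<le> d2" "d3 \<le> d2" | "d1 \<le> d2" "d2 \<le> d3" | "d2 \<le> d1" "d3 \<le> d2"
    by linarith
  then show ?thesis
  proof cases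
    case 1
    have "d2 + d1 + d3 = 2 * pi" using sum by linarith
    moreover have "\<not> (d2 = d1 \<and> d2 = d3)" using ne by blast
    ultimately have "sin d1 + sin d3 < 2 * sin d2"
      using smallest_gap_sin[of d2 d1 d3] pos(2) 1 by simp
    from less[OF this] show ?thesis
      unfolding down[OF 1(1)] up[OF 1(2)] ring_distribs by linarith
  next
    case 2
    \<comment> \<open>Each outer gap is at most \<open>d2\<close>, and the two together stay below 2
      pi.\<close>
    have lt: "d1 < pi" "d3 < pi" using 2 pos sum by linarith+
    have "sin d2 \<le> sin d1" using s21 2 lt by (cases "d1 = d2") auto
    moreover have "sin d2 \<le> sin d3" using s23 2 lt by (cases "d3 = d2") auto
    moreover have "d1 < d2 \<or> d3 < d2" using 2 ne by (auto simp: order_less_le)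
    then have "sin d2 < sin d1 \<or> sin d2 < sin d3" using s21 s23 lt by blast
    ultimately have "2 * sin d2 < sin d1 + sin d3" by linarith
    from less[OF this] show ?thesis
      unfolding up[OF 2(1)] down[OF 2(2)] ring_distribs by linarith
  next
    case 3
    \<comment> \<open>The two differences telescope to d3 - d1, so only the sines of the outer gaps
      have to be compared; the next case mirrors this one.\<close>
    have "d1 < d3" using 3 ne by (auto simp: order_less_le)
    moreover have "d2 < pi" using 3 pos sum by linarith
    ultimately have "sin d3 < sin d1" by (rule s31)
    from less[OF this] show ?thesis
      unfolding up[OF 3(1)] up[OF 3(2)] ring_distribs by linarith
  next
    case 4
    have "d3 < d1" using 4 ne by (auto simp: order_less_le)
    moreover have "d2 < pi" using 4 pos sum by linarith
    ultimately have "sin d1 < sin d3" by (rule s13)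
    from less[OF this] show ?thesis
      unfolding down[OF 4(1)] down[OF 4(2)] ring_distribs by linarith
  qed
qed

section \<open>The function V and the map in the plane\<close>

text \<open>The lift of V without reduction modulo 2 pi, hence continuous on the whole plane; it
  represents \<open>V_torus\<close> on \<open>triangle_region\<close>.\<close>

definition V_plane :: "real \<times> real \<Rightarrow> real" where
  "V_plane = (\<lambda>(x, y). \<bar>y - 2 * x\<bar> + \<bar>2 * pi + x - 2 * y\<bar>)"

abbreviation equilibrium :: "real \<times> real" where
  "equilibrium \<equiv> (2 * pi / 3, 4 * pi / 3)"

lemma equilibrium_in_triangle_region: "equilibrium \<in> triangle_region"
  by (simp add: triangle_region_def)

lemma V_plane_nonneg: "0 \<le> V_plane u"
  by (simp add: V_plane_def split_def)

lemma V_plane_equilibrium: "V_plane equilibrium = 0"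
  by (simp add: V_plane_def)

text \<open>With p = y - 2x and q = 2 pi + x - 2y, the deviations from the equilibrium are -(2p +
  q)/3 and -(p + 2q)/3, and V = |p| + |q|.\<close>

lemma V_plane_bounds_coords:
  "\<bar>x - 2 * pi / 3\<bar> \<le> 2 / 3 * V_plane (x, y)" "\<bar>y - 4 * pi / 3\<bar> \<le> 2 / 3 * V_plane (x, y)"
  by (auto simp: V_plane_def abs_if)

text \<open>The Euclidean norm is at most the sum of the two coordinate deviations, each bounded by
  2/3 V. This makes the equilibrium the only zero of V, bounds the sublevel sets and turns decay of
  V into convergence.\<close>

lemma dist_equilibrium_le: "dist u equilibrium \<le> 4 / 3 * V_plane u"
proof (cases u)
  case (Pair x y)
  have "dist u equilibrium \<le> \<bar>x - 2 * pi / 3\<bar> + \<bar>y - 4 * pi / 3\<bar>"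
    unfolding Pair dist_Pair_Pair dist_real_def by (rule sqrt_sum_squares_le_sum) auto
  with V_plane_bounds_coords[where x = x and y = y] show ?thesis by (simp add: Pair)
qed

lemma V_plane_eq_0_iff: "V_plane u = 0 \<longleftrightarrow> u = equilibrium"
proof
  assume "V_plane u = 0"
  with dist_equilibrium_le[of u] show "u = equilibrium" by simp
qed (simp add: V_plane_equilibrium)

lemma continuous_V_plane: "continuous_on A V_plane"
  unfolding V_plane_def split_def by (intro continuous_intros)

lemma continuous_plane_map: "continuous_on A (plane_map a)"
  unfolding plane_map_def split_def by (intro continuous_intros)

lemma plane_map_equilibrium: "plane_map a equilibrium = equilibrium"
proof -
  have "sin (4 * pi / 3) = - sin (2 * pi / 3)"
    using sin_2pi_minus[of "2 * pi / 3"] by (simp add: field_simps)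
  moreover have "sin (2 * pi / 3 - 4 * pi / 3) = - sin (2 * pi / 3)"
    by (simp flip: sin_minus)
  moreover have "sin (4 * pi / 3 - 2 * pi / 3) = sin (2 * pi / 3)"
    by (rule arg_cong[where f = sin]) simp
  ultimately show ?thesis by (simp add: plane_map_def)
qed

lemma V_plane_decreases:
  assumes a: "0 < a" "a < 1/3" and u: "u \<in> triangle_region" "u \<noteq> equilibrium"
  shows "V_plane (plane_map a u) < V_plane u"
proof -
  obtain x y where xy: "u = (x, y)" "0 < x" "x < y" "y < 2 * pi"
    using u(1) by (auto simp: triangle_region_def)
  have ne: "\<not> (x = y - x \<and> y - x = 2 * pi - y)"
  proof
    assume "x = y - x \<and> y - x = 2 * pi - y"
    then have "V_plane u = 0" by (auto simp: xy V_plane_def)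
    with u(2) show False by (simp add: V_plane_eq_0_iff)
  qed
  have sd: "sin (y - x) = - sin (x - y)" by (metis minus_diff_eq sin_minus)
  have sy: "sin (2 * pi - y) = - sin y" by (rule sin_2pi_minus)
  \<comment> \<open>The image gaps are these values of \<open>f\<close> for b = 3 a, minus the
    common term a (sin d1 + sin d2 + sin d3), which cancels in differences.\<close>
  have "\<bar>(y - x + 3 * a * sin (y - x)) - (x + 3 * a * sin x)\<bar>
      + \<bar>(2 * pi - y + 3 * a * sin (2 * pi - y)) - (y - x + 3 * a * sin (y - x))\<bar>
      < \<bar>(y - x) - x\<bar> + \<bar>(2 * pi - y) - (y - x)\<bar>"
    using a xy ne by (intro gap_differences_decrease) auto
  then show ?thesis
    unfolding sy by (simp add: xy V_plane_def plane_map_def sd algebra_simps)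
qed

lemma V_plane_nonincreasing:
  assumes "0 < a" "a < 1/3" "u \<in> triangle_region"
  shows "V_plane (plane_map a u) \<le> V_plane u"
proof (cases "u = equilibrium")
  case False
  then show ?thesis using V_plane_decreases[OF assms] by simp
qed (simp only: plane_map_equilibrium order_refl)

section \<open>Convergence of V along orbits, and its sublevel sets\<close>

text \<open>V decreases along the orbit to a limit L. By compactness the orbit has a cluster point
  l, and V l = L = V (f l) excludes l \<noteq> h, so L = V h.\<close>

lemma Lyapunov_orbit_converges:
  fixes f :: "'a::metric_space \<Rightarrow> 'a" and V :: "'a \<Rightarrow> real"
  assumes K: "compact K" "f ` K \<subseteq> K" and cont: "continuous_on K f" "continuous_on K V"
    and decr: "\<And>z. z \<in> K \<Longrightarrow> z \<noteq> h \<Longrightarrow> V (f z) < V z" and fixed: "f h = h" and z: "z \<in> K"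
  shows "(\<lambda>n. V ((f ^^ n) z)) \<longlonglongrightarrow> V h"
proof -
  have inK: "(f ^^ n) z \<in> K" for n
    using K(2) z by (induction n) auto
  have le: "V (f w) \<le> V w" if "w \<in> K" for w
    using decr[OF that] fixed by (cases "w = h") auto
  have "decseq (\<lambda>n. V ((f ^^ n) z))"
    using le inK by (intro decseq_SucI) simp
  moreover obtain m where "\<And>w. w \<in> K \<Longrightarrow> m \<le> V w"
    using continuous_attains_inf[OF K(1) _ cont(2)] z by blast
  ultimately obtain L where L: "(\<lambda>n. V ((f ^^ n) z)) \<longlonglongrightarrow> L"
    using decseq_convergent[of "\<lambda>n. V ((f ^^ n) z)" m] inK by blast
  obtain l r where l: "l \<in> K" "strict_mono r" "((\<lambda>n. (f ^^ n) z) \<circ> r) \<longlonglongrightarrow> l"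
    using K(1) inK unfolding compact_def by metis
  have lim: "(\<lambda>n. g ((f ^^ r n) z)) \<longlonglongrightarrow> g l" if "continuous_on K g" for g :: "'a \<Rightarrow> real"
    using continuous_on_tendsto_compose[OF that l(3) l(1)] inK by (simp add: o_def)
  have "(\<lambda>n. V ((f ^^ r n) z)) \<longlonglongrightarrow> L"
    using LIMSEQ_subseq_LIMSEQ[OF L l(2)] by (simp add: o_def)
  then have "V l = L" using lim[OF cont(2)] LIMSEQ_unique by blast
  \<comment> \<open>One further step along the subsequence tends to V (f l) by continuity, and still
    to L.\<close>
  moreover have "(\<lambda>n. V ((f ^^ Suc (r n)) z)) \<longlonglongrightarrow> L"
    using LIMSEQ_subseq_LIMSEQ[OF LIMSEQ_Suc[OF L] l(2)] by (simp add: o_def)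
  then have "V (f l) = L"
    using lim[OF continuous_on_compose2[OF cont(2,1) K(2)]] LIMSEQ_unique by fastforce
  ultimately have "l = h" using decr[OF l(1)] by fastforce
  with L \<open>V l = L\<close> show ?thesis by simp
qed

lemma compact_V_plane_sublevel: "compact {u. V_plane u \<le> c}"
proof -
  have "{u. V_plane u \<le> c} \<subseteq> cball equilibrium (4 / 3 * c)"
    using dist_equilibrium_le by (fastforce simp: dist_commute intro: order_trans)
  then have "bounded {u. V_plane u \<le> c}" by (rule bounded_subset[OF bounded_cball])
  moreover have "closed {u. V_plane u \<le> c}"
    by (intro closed_Collect_le continuous_V_plane continuous_on_const)
  ultimately show ?thesis by (simp add: compact_eq_bounded_closed)
qed

text \<open>At level pi / 4 both coordinate deviations are at most pi / 6, so x \<le> 5 pi / 6 < 7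
  pi / 6 \<le> y and the outer edges stay away as well.\<close>

lemma V_plane_sublevel_triangle_region: "V_plane u \<le> pi / 4 \<Longrightarrow> u \<in> triangle_region"
proof (cases u)
  case (Pair x y)
  assume "V_plane u \<le> pi / 4"
  then have "\<bar>x - 2 * pi / 3\<bar> \<le> pi / 6" "\<bar>y - 4 * pi / 3\<bar> \<le> pi / 6"
    using V_plane_bounds_coords[where x = x and y = y] unfolding Pair by linarith+
  then have "0 < x" "x < y" "y < 2 * pi"
    using pi_gt_zero by linarith+
  then show ?thesis by (simp add: Pair triangle_region_def)
qed

section \<open>Passage from the plane to the torus\<close>

text \<open>The saturation of U is a union of lattice translates of U: the translate by w - u is a
  neighbourhood of w inside it.\<close>

lemma open_torus_proj_image:
  assumes "open U"
  shows "open (torus_proj ` U)"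
  unfolding open_torus2_iff
proof (subst open_subopen, intro ballI)
  fix w assume "w \<in> torus_proj -` torus_proj ` U"
  then obtain u where u: "u \<in> U" "torus_proj w = torus_proj u" by blast
  then have wu: "lattice_cong w u" by (simp only: torus_proj_eq_iff)
  let ?T = "(\<lambda>v. v - w + u) -` U"
  have "torus_proj v = torus_proj (v - w + u)" for v
    unfolding torus_proj_eq_iff
    using lattice_cong_add[OF lattice_cong_refl[of "v - w"] wu] by simp
  then have "?T \<subseteq> torus_proj -` torus_proj ` U" by (metis imageI subsetI vimageE vimageI)
  moreover have "open ?T" using assms by (intro open_vimage continuous_intros)
  moreover have "w \<in> ?T" using u by simp
  ultimately show "\<exists>T. open T \<and> w \<in> T \<and> T \<subseteq> torus_proj -` torus_proj ` U" by blast
qed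

lemma open_triangle_region: "open triangle_region"
proof -
  have "triangle_region = {u. 0 < fst u} \<inter> {u. fst u < 2 * pi} \<inter> {u. 0 < snd u}
      \<inter> {u. snd u < 2 * pi} \<inter> {u. fst u < snd u}"
    by (auto simp: triangle_region_def)
  also have "open \<dots>" by (intro open_Int open_Collect_less continuous_intros)
  finally show ?thesis .
qed

lemma open_S_torus: "open S_torus"
  unfolding S_torus_def by (intro open_torus_proj_image open_triangle_region)

lemma V_torus_proj: "u \<in> triangle_region \<Longrightarrow> V_torus (torus_proj u) = V_plane u"
  by (auto simp: V_torus_def V_plane_def triangle_region_def torus_coords_proj)

text \<open>Since \<open>torus_proj\<close> is open, preimages under V are images of open subsets of
  the triangle; this bypasses \<open>torus_coords\<close>, which jumps at the edges of the
  square.\<close>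

lemma continuous_V_torus: "continuous_on S_torus V_torus"
  unfolding continuous_on_open_vimage[OF open_S_torus]
proof (intro allI impI)
  fix B :: "real set" assume "open B"
  have "V_torus -` B \<inter> S_torus = torus_proj ` (triangle_region \<inter> V_plane -` B)"
    by (auto simp: S_torus_def V_torus_proj)
  also have "open \<dots>"
    using \<open>open B\<close> by (intro open_torus_proj_image open_Int open_triangle_region open_vimage continuous_V_plane)
  finally show "open (V_torus -` B \<inter> S_torus)" .
qed

section \<open>Orbits on the torus and stability\<close>

lemma funpow_torus_map: "(torus_map a ^^ n) (torus_proj u) = torus_proj ((plane_map a ^^ n) u)"
  by (induction n) (simp_all add: torus_map.abs_eq)

lemma funpow_plane_map_triangle_region:
  "0 < a \<Longrightarrow> a < 1/3 \<Longrightarrow> u \<in> triangle_region \<Longrightarrow> (plane_map a ^^ n) u \<in> triangle_region"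
  by (induction n) (auto intro: plane_map_triangle_region)

lemma V_plane_funpow_le:
  assumes "0 < a" "a < 1/3" "u \<in> triangle_region"
  shows "V_plane ((plane_map a ^^ n) u) \<le> V_plane u"
proof (induction n)
  case (Suc n)
  with V_plane_nonincreasing[OF assms(1,2) funpow_plane_map_triangle_region[OF assms, of n]]
  show ?case by simp
qed simp

text \<open>Projection does not increase distances, so both stability and attraction can be read off
  from V along the lifted orbit.\<close>

lemma dist_torus_map_equilibrium_le:
  "dist ((torus_map a ^^ n) (torus_proj u)) (torus_proj equilibrium)
    \<le> 4 / 3 * V_plane ((plane_map a ^^ n) u)"
  unfolding funpow_torus_map by (rule order_trans[OF dist_torus_proj_le dist_equilibrium_le])

lemma sublevel_neighbourhood:
  assumes "0 < c"
  shows "set_neighbourhood (torus_proj ` {u \<in> triangle_region. V_plane u < c}) H1"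
proof -
  have "open (triangle_region \<inter> {u. V_plane u < c})"
    by (intro open_Int open_triangle_region open_Collect_less continuous_V_plane continuous_on_const)
  then have "open (torus_proj ` {u \<in> triangle_region. V_plane u < c})"
    by (intro open_torus_proj_image) (simp add: Int_def)
  then show ?thesis
    using assms V_plane_equilibrium equilibrium_in_triangle_region
    unfolding set_neighbourhood_def H1_def by fastforce
qed

lemma strict_lyapunov_function_V_torus:
  assumes "0 < a" "a < 1/3"
  shows "strict_lyapunov_function (torus_map a) S_torus H1 V_torus"
proof -
  have deriv: "orbital_derivative (torus_map a) V_torus (torus_proj u)
      = V_plane (plane_map a u) - V_plane u" if "u \<in> triangle_region" for u
    using that plane_map_triangle_region[OF assms that]
    by (simp add: orbital_derivative_def torus_map.abs_eq V_torus_proj)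
  have off: "\<exists>u \<in> triangle_region. z = torus_proj u \<and> u \<noteq> equilibrium" if "z \<in> S_torus - H1" for z
    using that by (auto simp: S_torus_def H1_def)
  show ?thesis
    unfolding strict_lyapunov_function_def lyapunov_function_def
  proof (intro conjI ballI)
    show "open S_torus" by (rule open_S_torus)
    show "continuous_on S_torus V_torus" by (rule continuous_V_torus)
    show "compact H1" by (simp add: H1_def)
    show "H1 \<subseteq> S_torus"
      using equilibrium_in_triangle_region by (auto simp: H1_def S_torus_def)
  next
    fix z assume "z \<in> S_torus"
    then show "orbital_derivative (torus_map a) V_torus z \<le> 0"
      using V_plane_nonincreasing[OF assms] by (auto simp: S_torus_def deriv)
  next
    fix z assume "z \<in> H1"
    then show "V_torus z = 0"
      using V_torus_proj[OF equilibrium_in_triangle_region] V_plane_equilibrium by (simp add: H1_def)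
  next
    fix z assume "z \<in> S_torus - H1"
    from off[OF this] obtain u where u: "u \<in> triangle_region" "z = torus_proj u" "u \<noteq> equilibrium"
      by blast
    then have "V_plane u \<noteq> 0" by (simp add: V_plane_eq_0_iff)
    then show "0 < V_torus z"
      using u V_plane_nonneg[of u] by (simp add: V_torus_proj)
    show "orbital_derivative (torus_map a) V_torus z < 0"
      using u V_plane_decreases[OF assms] by (simp add: deriv)
  qed
qed

lemma lyapunov_stable_H1:
  assumes "0 < a" "a < 1/3"
  shows "lyapunov_stable (torus_map a) H1"
  unfolding lyapunov_stable_def
proof (intro conjI allI impI)
  show "compact H1" by (simp add: H1_def)
  fix U assume "set_neighbourhood U H1"
  then obtain T where T: "open T" "torus_proj equilibrium \<in> T" "T \<subseteq> U"
    by (auto simp: set_neighbourhood_def H1_def)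
  then obtain e where e: "0 < e" "\<And>q. dist q (torus_proj equilibrium) < e \<Longrightarrow> q \<in> U"
    unfolding open_dist by blast
  \<comment> \<open>The factor 3/4 cancels the 4/3 in the distance bound; V does not grow along
    orbits.\<close>
  let ?W = "torus_proj ` {u \<in> triangle_region. V_plane u < 3 / 4 * e}"
  have "(torus_map a ^^ n) z \<in> U" if "z \<in> ?W" for z n
  proof -
    obtain u where u: "u \<in> triangle_region" "V_plane u < 3 / 4 * e" "z = torus_proj u"
      using \<open>z \<in> ?W\<close> by blast
    show ?thesis
      using dist_torus_map_equilibrium_le[of n a u] V_plane_funpow_le[OF assms u(1), of n] u(2)
      by (intro e(2)) (simp add: u(3))
  qed
  moreover have "set_neighbourhood ?W H1" using e(1) by (intro sublevel_neighbourhood) simp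
  ultimately show "\<exists>W. set_neighbourhood W H1 \<and> (\<forall>z\<in>W. \<forall>n. (torus_map a ^^ n) z \<in> U)" by blast
qed

lemma asymptotically_stable_H1:
  assumes "0 < a" "a < 1/3"
  shows "asymptotically_stable (torus_map a) H1"
proof -
  \<comment> \<open>The level pi / 4 keeps the closed sublevel set inside the triangle, so it is
    compact and forward invariant. The limit is taken in the plane and projected afterwards.\<close>
  let ?K = "{u. V_plane u \<le> pi / 4}"
  let ?W = "torus_proj ` {u \<in> triangle_region. V_plane u < pi / 4}"
  have "(\<lambda>n. infdist ((torus_map a ^^ n) z) H1) \<longlonglongrightarrow> 0" if "z \<in> ?W" for z
  proof -
    obtain u where u: "V_plane u < pi / 4" "z = torus_proj u"
      using \<open>z \<in> ?W\<close> by blast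
    have "(\<lambda>n. V_plane ((plane_map a ^^ n) u)) \<longlonglongrightarrow> V_plane equilibrium"
    proof (rule Lyapunov_orbit_converges[OF compact_V_plane_sublevel])
      have "V_plane (plane_map a v) \<le> pi / 4" if "V_plane v \<le> pi / 4" for v
        using V_plane_nonincreasing[OF assms V_plane_sublevel_triangle_region[OF that]] that by simp
      then show "plane_map a ` ?K \<subseteq> ?K" by blast
      show "V_plane (plane_map a v) < V_plane v" if "v \<in> ?K" "v \<noteq> equilibrium" for v
        using that V_plane_decreases[OF assms V_plane_sublevel_triangle_region] by simp
    qed (use u in \<open>auto intro: continuous_plane_map continuous_V_plane plane_map_equilibrium\<close>)
    then have "(\<lambda>n. 4 / 3 * V_plane ((plane_map a ^^ n) u)) \<longlonglongrightarrow> 0"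
      using tendsto_mult_right_zero by (simp add: V_plane_equilibrium)
    then show ?thesis
      \<comment> \<open>Squeeze between 0 and 4/3 V; the distance to the singleton \<open>H1\<close>
        is the distance to its point.\<close>
      by (rule tendsto_sandwich[OF _ _ tendsto_const, rotated 2])
        (use dist_torus_map_equilibrium_le in \<open>simp_all add: H1_def u(2) infdist_nonneg\<close>)
  qed
  then show ?thesis
    unfolding asymptotically_stable_def
    using lyapunov_stable_H1[OF assms] sublevel_neighbourhood[of "pi / 4"] by fastforce
qed

theorem theorem6:
  fixes a :: real
  assumes "0 < a" and "a < 1/3"
  shows "strict_lyapunov_function (torus_map a) S_torus H1 V_torus
       \<and> asymptotically_stable (torus_map a) H1"
  using strict_lyapunov_function_V_torus[OF assms] asymptotically_stable_H1[OF assms] by blast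

end
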